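(* For every connected graph $G$, $\mathrm{pc}_{\mathrm{opt}}(G)\le \frac{5\alpha(G)-1}{2}$.
   Context: All graphs are simple, finite and have at least one vertex. $\alpha(G)$ denotes the independence number of $G$. An edge-colored graph is properly colored if no two adjacent edges (edges sharing an endpoint) have the same color. An edge-colored connected graph $G$ is properly connected if between every pair of distinct vertices of $G$ there is a properly colored path (the edge-coloring of $G$ itself need not be proper). Optimal proper connection number: let $G$ be a connected graph, and suppose initially all edges of $G$ are colored by color $1$. Then $\mathrm{pc}_{\mathrm{opt}}(G)$ is the minimum of $p+q$ over all nonnegative integers $p,q$ such that, by recoloring $p$ edges of $G$ with $q$ new colors (colors different from $1$), the remaining edges keeping color $1$, one can make $G$ properly connected. (Here $p$ is the number of recolored edges and $q$ is the number of new colors used; $p=q=0$ is allowed.) *)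

theory Defs
  imports Complex_Main "HOL-Library.Ramsey"
begin

text \<open>A graph is a vertex set \<open>V\<close> with a set \<open>E\<close> of two-element subsets of \<open>V\<close>.\<close>

definition simple_graph :: "'a set \<Rightarrow> 'a set set \<Rightarrow> bool" where
  "simple_graph V E \<longleftrightarrow> finite V \<and> V \<noteq> {} \<and> E \<subseteq> [V]\<^bsup>2\<^esup>"

text \<open>Paths are given by their nonempty lists of pairwise distinct vertices.\<close>

definition path_between :: "'a set \<Rightarrow> 'a set set \<Rightarrow> 'a \<Rightarrow> 'a list \<Rightarrow> 'a \<Rightarrow> bool" where
  "path_between V E u xs v \<longleftrightarrow>
     xs \<noteq> [] \<and> set xs \<subseteq> V \<and> distinct xs \<and> successively (\<lambda>x y. {x, y} \<in> E) xs \<and>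
     hd xs = u \<and> last xs = v"

definition path_edges :: "'a list \<Rightarrow> 'a set set" where
  "path_edges xs = {{xs ! i, xs ! Suc i} | i. Suc i < length xs}"

definition connected_graph :: "'a set \<Rightarrow> 'a set set \<Rightarrow> bool" where
  "connected_graph V E \<longleftrightarrow>
     simple_graph V E \<and> (\<forall>u\<in>V. \<forall>v\<in>V. \<exists>xs. path_between V E u xs v)"

definition independence_number :: "'a set \<Rightarrow> 'a set set \<Rightarrow> nat" where
  "independence_number V E = Max {card S | S. S \<subseteq> V \<and> indep S E}"

definition properly_colored :: "('a set \<Rightarrow> nat) \<Rightarrow> 'a set set \<Rightarrow> bool" where
  "properly_colored c F \<longleftrightarrow>
     (\<forall>e\<in>F. \<forall>f\<in>F. e \<noteq> f \<and> e \<inter> f \<noteq> {} \<longrightarrow> c e \<noteq> c f)"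

definition properly_connected :: "'a set \<Rightarrow> 'a set set \<Rightarrow> ('a set \<Rightarrow> nat) \<Rightarrow> bool" where
  "properly_connected V E c \<longleftrightarrow>
     (\<forall>u\<in>V. \<forall>v\<in>V. u \<noteq> v \<longrightarrow>
        (\<exists>xs. path_between V E u xs v \<and> properly_colored c (path_edges xs)))"

text \<open>\<open>c\<close> arises from the all-1 coloring of \<open>E\<close> by recoloring \<open>p\<close> edges (the set \<open>R\<close>) with
  \<open>q\<close> new colors, each of which is used. Values of \<open>c\<close> outside \<open>E\<close> are irrelevant.\<close>

definition recoloring :: "'a set set \<Rightarrow> nat \<Rightarrow> nat \<Rightarrow> ('a set \<Rightarrow> nat) \<Rightarrow> bool" where
  "recoloring E p q c \<longleftrightarrow>
     (\<exists>R\<subseteq>E. card R = p \<and> card (c ` R) = q \<and> 1 \<notin> c ` R \<and> (\<forall>e\<in>E - R. c e = 1))"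

definition pc_opt :: "'a set \<Rightarrow> 'a set set \<Rightarrow> nat" where
  "pc_opt V E =
     (LEAST n. \<exists>p q c. n = p + q \<and> recoloring E p q c \<and> properly_connected V E c)"

lemma simple_graph_finite_edges: "simple_graph V E \<Longrightarrow> finite E"
  unfolding simple_graph_def by (meson finite_imp_finite_nsets finite_subset)

lemma path_edges_subset:
  assumes "path_between V E u xs v"
  shows "path_edges xs \<subseteq> E"
  using assms unfolding path_between_def path_edges_def
  by (auto simp: successively_conv_nth)

text \<open>For connected graphs, the minimum defining \<^const>\<open>pc_opt\<close> ranges over a nonempty set and
  is therefore attained.\<close>

lemma pc_opt_attained:
  assumes "connected_graph V E"
  shows "\<exists>p q c. pc_opt V E = p + q \<and> recoloring E p q c \<and> properly_connected V E c"
proof -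
  have "finite E"
    using assms by (simp add: connected_graph_def simple_graph_finite_edges[of V])
  from finite_imp_inj_to_nat_seg[OF this]
  obtain h :: "'a set \<Rightarrow> nat" where h: "inj_on h E"
    by auto
  define c where "c e = h e + 2" for e
  have inj: "inj_on c E" using h by (auto simp: inj_on_def c_def)
  have "recoloring E (card E) (card (c ` E)) c"
    unfolding recoloring_def by (rule exI[of _ E]) (auto simp: c_def)
  moreover have "properly_connected V E c"
    unfolding properly_connected_def
  proof (intro ballI impI)
    fix u v assume "u \<in> V" "v \<in> V"
    then obtain xs where xs: "path_between V E u xs v"
      using assms unfolding connected_graph_def by blast
    have "properly_colored c (path_edges xs)"
      using path_edges_subset[OF xs] inj unfolding properly_colored_def
      by (meson inj_onD subsetD)
    with xs show "\<exists>xs. path_between V E u xs v \<and> properly_colored c (path_edges xs)" by blast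
  qed
  ultimately have "\<exists>p q c'. card E + card (c ` E) = p + q \<and> recoloring E p q c' \<and>
      properly_connected V E c'"
    by (intro exI conjI) (rule refl)
  then show ?thesis unfolding pc_opt_def by (rule LeastI)
qed

end

theory Submission
  imports Defs
begin

text \<open>
  Recolor exactly the edges of a subtree \<open>T\<close> of \<open>G\<close>, properly and with at most as many new colors
  as its maximum degree \<open>h\<close>. All pairs of vertices are then joined by proper paths if \<open>T\<close> contains
  an independent set \<open>S\<close> that dominates the vertices outside \<open>T\<close> and such that any two nonadjacent
  vertices \<open>x\<close>, \<open>y\<close> outside \<open>T\<close> have distinct neighbors \<open>s\<close>, \<open>s'\<close> in \<open>S\<close>: the path runs from \<open>x\<close>
  to \<open>s\<close>, inside \<open>T\<close> to \<open>s'\<close>, and then to \<open>y\<close>, so that color 1 is used only at its two ends.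

  Let \<open>m\<close> be the largest size of an independent set inside a neighborhood; \<open>m \<ge> 2\<close> unless \<open>G\<close> is
  complete. Start with such a star, \<open>S\<close> being its leaves. As long as one of the two properties fails,
  \<open>S\<close> grows by one element (in the second case \<open>s\<close> is exchanged for \<open>x\<close> and \<open>y\<close>) while at most two
  vertices are attached to \<open>T\<close>, so \<open>T\<close> ends with at most \<open>2 \<alpha> - m\<close> edges. Rearranging \<open>T\<close> on its
  vertex set whenever a vertex is attached keeps its maximum degree at most
  \<open>h = m + (\<alpha> - 1) div 2\<close>, and \<open>(2 \<alpha> - m) + h \<le> (5 \<alpha> - 1) / 2\<close>.
\<close>

definition neighbors :: "'a set set \<Rightarrow> 'a \<Rightarrow> 'a set" where
  "neighbors E v = {w. {v, w} \<in> E}"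

subsection \<open>Trees\<close>

text \<open>Trees are generated by attaching leaves, so that facts about them follow by induction on
  the last leaf. The vertex set is carried along because the one-vertex tree has no edges to recover
  it from.\<close>

inductive tree :: "'a set \<Rightarrow> 'a set set \<Rightarrow> bool" where
  single: "tree {v} {}"
| leaf: "tree U T \<Longrightarrow> t \<in> U \<Longrightarrow> x \<notin> U \<Longrightarrow> tree (insert x U) (insert {t, x} T)"

lemma tree_edge: "tree U T \<Longrightarrow> {a, b} \<in> T \<Longrightarrow> a \<in> U \<and> b \<in> U \<and> a \<noteq> b"
  by (induction arbitrary: a b rule: tree.induct) (auto simp: doubleton_eq_iff)

lemma tree_edge_subset: "tree U T \<Longrightarrow> e \<in> T \<Longrightarrow> e \<subseteq> U"
  by (induction arbitrary: e rule: tree.induct) auto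

lemma tree_finite: "tree U T \<Longrightarrow> finite U \<and> finite T"
  by (induction rule: tree.induct) auto

lemma tree_card: "tree U T \<Longrightarrow> card U = Suc (card T)"
proof (induction rule: tree.induct)
  case (leaf U T t x)
  then have "{t, x} \<notin> T" using tree_edge by metis
  with leaf tree_finite[OF leaf.hyps(1)] show ?case by simp
qed simp

lemma tree_neighbors_subset: "tree U T \<Longrightarrow> neighbors T t \<subseteq> U"
  using tree_edge unfolding neighbors_def by fastforce

lemma tree_finite_neighbors: "tree U T \<Longrightarrow> finite (neighbors T t)"
  by (meson finite_subset tree_finite tree_neighbors_subset)

lemma neighbors_leaf:
  assumes "tree U T" "t \<in> U" "x \<notin> U"
  shows "neighbors (insert {t, x} T) y =
    (if y = t then insert x (neighbors T t) else if y = x then {t} else neighbors T y)"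
  using assms tree_edge[OF assms(1)] by (auto simp: neighbors_def doubleton_eq_iff)

lemma card_neighbors_leaf:
  assumes "tree U T" "t \<in> U" "x \<notin> U"
  shows "card (neighbors (insert {t, x} T) y) =
    (if y = t then Suc (card (neighbors T t)) else if y = x then 1 else card (neighbors T y))"
proof -
  have "x \<notin> neighbors T t" using tree_neighbors_subset[OF assms(1)] assms(3) by blast
  then show ?thesis
    using tree_finite_neighbors[OF assms(1), of t] by (simp add: neighbors_leaf[OF assms])
qed

text \<open>The edges of \<open>T\<close> counted twice in this sum lie inside \<open>A\<close>, where they form a forest.\<close>

lemma tree_sum_degree:
  assumes "tree U T" "A \<subseteq> U" "A \<noteq> {}"
  shows "(\<Sum>a\<in>A. card (neighbors T a)) < card T + card A"
  using assms
proof (induction arbitrary: A rule: tree.induct)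
  case (single v)
  then have "A = {v}" by auto
  then show ?case by (simp add: neighbors_def)
next
  case (leaf U T t x)
  have fin: "finite U" "finite T" using tree_finite[OF leaf.hyps(1)] by auto
  have new: "{t, x} \<notin> T" using leaf.hyps tree_edge by metis
  \<comment> \<open>The leaf \<open>x\<close> lies outside the old tree, so the induction hypothesis
    can only be applied to \<open>B\<close>. If \<open>A = {x}\<close>, then \<open>B\<close> is
    empty and the count is done directly.\<close>
  define B where "B = A - {x}"
  have B: "B \<subseteq> U" "finite B" "x \<notin> B" using leaf.prems fin by (auto simp: B_def intro: finite_subset)
  have "(\<Sum>a\<in>B. card (neighbors (insert {t, x} T) a))
      = (\<Sum>a\<in>B. card (neighbors T a) + (if a = t then 1 else 0))"
    using B by (intro sum.cong) (auto simp: card_neighbors_leaf[OF leaf.hyps])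
  also have "\<dots> = (\<Sum>a\<in>B. card (neighbors T a)) + (if t \<in> B then 1 else 0)"
    using B by (simp add: sum.distrib)
  finally have sumB: "(\<Sum>a\<in>B. card (neighbors (insert {t, x} T) a))
      = (\<Sum>a\<in>B. card (neighbors T a)) + (if t \<in> B then 1 else 0)" .
  have IH: "(\<Sum>a\<in>B. card (neighbors T a)) < card T + card B" if "B \<noteq> {}"
    using leaf.IH B that by blast
  have xt: "x \<noteq> t" using leaf.hyps by auto
  show ?case
  proof (cases "x \<in> A")
    case True
    then have A: "A = insert x B" by (auto simp: B_def)
    show ?thesis
      using IH sumB B new fin xt unfolding A
      by (cases "B = {}") (auto simp: card_neighbors_leaf[OF leaf.hyps])
  next
    case False
    then have "A = B" by (auto simp: B_def)
    then show ?thesis using IH sumB new fin leaf.prems by auto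
  qed
qed

text \<open>If \<open>{a, b}\<close> is the last leaf edge, \<open>x\<close> is attached first and
  the leaf \<open>y\<close> is then attached to \<open>x\<close>. Otherwise the smaller tree is
  subdivided and the leaf is put back.\<close>

lemma tree_subdivide:
  assumes "tree U T" "{a, b} \<in> T" "x \<notin> U"
  shows "tree (insert x U) (insert {a, x} (insert {x, b} (T - {{a, b}})))"
  using assms
proof (induction arbitrary: a b rule: tree.induct)
  case (leaf U T t y)
  have new: "{t, y} \<notin> T" using leaf.hyps tree_edge by metis
  have x: "x \<notin> U" "x \<noteq> y" using leaf.prems by auto
  show ?case
  proof (cases "{a, b} = {t, y}")
    case True
    have "tree (insert y (insert x U)) (insert {x, y} (insert {t, x} T))"
      using leaf.hyps x by (intro tree.leaf) auto
    moreover have "insert {a, x} (insert {x, b} (insert {t, y} T - {{a, b}}))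
        = insert {x, y} (insert {t, x} T)"
      using True new by (auto simp: doubleton_eq_iff insert_commute)
    ultimately show ?thesis by (simp add: insert_commute)
  next
    case False
    then have "tree (insert x U) (insert {a, x} (insert {x, b} (T - {{a, b}})))"
      using leaf x by auto
    then have "tree (insert y (insert x U))
        (insert {t, y} (insert {a, x} (insert {x, b} (T - {{a, b}}))))"
      using leaf.hyps x by (intro tree.leaf[of "insert x U"]) auto
    moreover have "insert {t, y} T - {{a, b}} = insert {t, y} (T - {{a, b}})"
      using False by auto
    ultimately show ?thesis by (simp add: insert_commute)
  qed
qed simp

text \<open>Without \<open>{t, w'}\<close> the tree has two parts, one with \<open>t\<close> and
  \<open>w\<close>, the other with \<open>w'\<close>, and \<open>{w, w'}\<close> joins them again.
  In the induction, a last leaf \<open>w'\<close> is attached to \<open>w\<close> in place of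
  \<open>t\<close>; if \<open>w\<close> is the last leaf, the result is the old tree with
  \<open>{t, w'}\<close> subdivided by \<open>w\<close>.\<close>

lemma tree_swap:
  assumes "tree U T" "{t, w} \<in> T" "{t, w'} \<in> T" "w \<noteq> w'"
  shows "tree U (insert {w, w'} (T - {{t, w'}}))"
  using assms
proof (induction rule: tree.induct)
  case (leaf U T p x)
  have new: "{p, x} \<notin> T" using leaf.hyps tree_edge by metis
  have xnb: "{y, x} \<notin> T" for y using leaf.hyps tree_edge by metis
  consider "{t, w'} = {p, x}" | "{t, w} = {p, x}" "{t, w'} \<in> T" | "{t, w} \<in> T" "{t, w'} \<in> T"
    using leaf.prems by auto
  then show ?case
  proof cases
    case 1
    then have tw: "{t, w} \<in> T" using leaf.prems by (auto simp: doubleton_eq_iff)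
    then have "w' = x" "t = p" using 1 xnb[of w] by (auto simp: doubleton_eq_iff insert_commute)
    moreover have "w \<in> U" using tree_edge[OF leaf.hyps(1) tw] by simp
    ultimately show ?thesis using tree.leaf[OF leaf.hyps(1), of w x] leaf.hyps new by simp
  next
    case 2
    then have "w = x" "t = p" using xnb[of w'] by (auto simp: doubleton_eq_iff insert_commute)
    moreover have "{p, x} \<noteq> {p, w'}" using leaf.prems \<open>w = x\<close> by (auto simp: doubleton_eq_iff)
    then have "insert {p, x} T - {{p, w'}} = insert {p, x} (T - {{p, w'}})" by auto
    ultimately show ?thesis
      using tree_subdivide[OF leaf.hyps(1) 2(2) leaf.hyps(3)] by (simp add: insert_commute)
  next
    case 3
    then have "insert {p, x} T - {{t, w'}} = insert {p, x} (T - {{t, w'}})" using new by auto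
    then show ?thesis
      using tree.leaf[OF leaf.IH[OF 3 leaf.prems(3)] leaf.hyps(2,3)] by (simp add: insert_commute)
  qed
qed simp

lemma tree_path: "tree U T \<Longrightarrow> u \<in> U \<Longrightarrow> v \<in> U \<Longrightarrow> \<exists>xs. path_between U T u xs v"
proof (induction arbitrary: u v rule: tree.induct)
  case (single w)
  then have "path_between {w} {} u [w] v" by (simp add: path_between_def)
  then show ?case by blast
next
  case (leaf U T t x)
  have mono: "successively (\<lambda>a b. {a, b} \<in> insert {t, x} T) xs"
    if "successively (\<lambda>a b. {a, b} \<in> T) xs" for xs
    using that by (rule successively_mono) auto
  consider "u = x" "v = x" | "u = x" "v \<in> U" | "u \<in> U" "v = x" | "u \<in> U" "v \<in> U"
    using leaf.prems by auto
  then show ?case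
  proof cases
    case 1
    then have "path_between (insert x U) (insert {t, x} T) u [x] v"
      by (simp add: path_between_def)
    then show ?thesis by blast
  next
    case 2
    then obtain xs where "path_between U T t xs v" using leaf by blast
    then have "path_between (insert x U) (insert {t, x} T) u (x # xs) v"
      using 2 leaf.hyps mono[of xs]
      by (auto simp: path_between_def successively_Cons insert_commute)
    then show ?thesis by blast
  next
    case 3
    then obtain xs where "path_between U T u xs t" using leaf by blast
    then have "path_between (insert x U) (insert {t, x} T) u (xs @ [x]) v"
      using 3 leaf.hyps mono[of xs]
      by (auto simp: path_between_def successively_append_iff)
    then show ?thesis by blast
  next
    case 4
    then obtain xs where "path_between U T u xs v" using leaf by blast
    then have "path_between (insert x U) (insert {t, x} T) u xs v"
      using mono[of xs] by (auto simp: path_between_def)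
    then show ?thesis by blast
  qed
qed

subsection \<open>Proper edge colorings of trees\<close>

lemma properly_colored_insert:
  assumes "properly_colored c F"
    and "\<And>f. f \<in> F \<Longrightarrow> e \<noteq> f \<Longrightarrow> e \<inter> f \<noteq> {} \<Longrightarrow> c e \<noteq> c f"
  shows "properly_colored c (insert e F)"
  using assms unfolding properly_colored_def by (metis inf_commute insert_iff)

lemma properly_colored_subset: "properly_colored c F \<Longrightarrow> F' \<subseteq> F \<Longrightarrow> properly_colored c F'"
  unfolding properly_colored_def by blast

text \<open>Greedy coloring: a new leaf edge meets only the old edges at \<open>t\<close>, of which
  there are fewer than \<open>h\<close>. The palette of \<open>h\<close> colors starts at 2, which
  keeps color 1 for the edges outside the tree.\<close>

lemma tree_coloring:
  assumes "tree U T" "\<And>t. card (neighbors T t) \<le> h"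
  shows "\<exists>c. c ` T \<subseteq> {2..<h + 2} \<and> properly_colored c T"
  using assms
proof (induction rule: tree.induct)
  case (leaf U T t x)
  note deg = card_neighbors_leaf[OF leaf.hyps]
  have "card (neighbors T y) \<le> h" for y
  proof (cases "y = x")
    case True
    then have "neighbors T y = {}" using leaf.hyps tree_edge by (fastforce simp: neighbors_def)
    then show ?thesis by simp
  next
    case False
    then show ?thesis using leaf.prems[of y] deg[of y] by (auto split: if_splits)
  qed
  then obtain c where c: "c ` T \<subseteq> {2..<h + 2}" "properly_colored c T" using leaf.IH by blast
  let ?C = "(\<lambda>w. c {t, w}) ` neighbors T t"
  have finN: "finite (neighbors T t)" using tree_finite_neighbors[OF leaf.hyps(1)] .
  have "card ?C < card {2..<h + 2}"
    using card_image_le[OF finN, of "\<lambda>w. c {t, w}"] leaf.prems[of t] deg[of t] by simp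
  then obtain a where a: "a \<in> {2..<h + 2}" "a \<notin> ?C"
    using finN by (meson card_mono finite_imageI not_le subsetI)
  have new: "{t, x} \<notin> T" using leaf.hyps tree_edge by metis
  let ?c = "c({t, x} := a)"
  have cT: "?c e = c e" if "e \<in> T" for e using that new by auto
  have "properly_colored ?c T"
    using c(2) cT unfolding properly_colored_def by metis
  moreover have "?c {t, x} \<noteq> ?c f" if f: "f \<in> T" "{t, x} \<inter> f \<noteq> {}" for f
  proof -
    have "x \<notin> f" using f leaf.hyps tree_edge_subset by blast
    then have "t \<in> f" using f by auto
    have "\<exists>w. f = {t, w}"
      using leaf.hyps(1) f(1) \<open>t \<in> f\<close> by (induction rule: tree.induct) auto
    then obtain w where "f = {t, w}" by blast
    then have "c f \<in> ?C" using f(1) by (auto simp: neighbors_def)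
    then show ?thesis using a(2) cT[OF f(1)] by auto
  qed
  ultimately have "properly_colored ?c (insert {t, x} T)"
    by (rule properly_colored_insert)
  moreover have "?c ` insert {t, x} T \<subseteq> {2..<h + 2}"
    using c(1) a(1) by auto
  ultimately show ?case by blast
qed (auto simp: properly_colored_def)

subsection \<open>Spanning trees of bounded degree\<close>

text \<open>Only the vertex set is recorded, because the tree on it may be rearranged at every
  attachment.\<close>

definition spanned :: "'a set set \<Rightarrow> nat \<Rightarrow> 'a set \<Rightarrow> bool" where
  "spanned E h U \<longleftrightarrow> (\<exists>T\<subseteq>E. tree U T \<and> (\<forall>t. card (neighbors T t) \<le> h))"

text \<open>For rearrangements of a tree: a vertex that trades its neighbor \<open>w\<close> for
  \<open>x\<close> does not gain degree.\<close>

lemma card_le_exchange: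
  assumes "finite N" "w \<in> N" "M \<subseteq> insert x (N - {w})"
  shows "card M \<le> card N"
proof -
  have "card M \<le> card (insert x (N - {w}))" using assms by (intro card_mono) auto
  also have "\<dots> \<le> Suc (card (N - {w}))" using assms(1) by (simp add: card_insert_if)
  also have "\<dots> = card N" using assms by (metis card.remove)
  finally show ?thesis .
qed

text \<open>
  Suppose \<open>t\<close> already has degree \<open>h\<close>, with neighbors \<open>N\<close> in the tree. An edge \<open>{x, w}\<close> with \<open>w \<in> N\<close>
  lets \<open>x\<close> subdivide \<open>{t, w}\<close>; an edge \<open>{w, w'}\<close> inside \<open>N\<close> at a vertex \<open>w\<close> of degree below \<open>h\<close>
  can replace \<open>{t, w'}\<close>. Otherwise \<open>x\<close>, the non-full vertices of \<open>N\<close> and one full vertex form an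
  independent set that is too large, since \<open>small\<close> allows at most \<open>r\<close> full vertices in \<open>N\<close>.
\<close>

lemma spanned_attach:
  assumes sp: "spanned E h U" and tx: "t \<in> U" "x \<notin> U" "{t, x} \<in> E"
    and h: "h \<ge> 2" and r: "r \<ge> 1"
    and star: "\<And>I. I \<subseteq> neighbors E t \<Longrightarrow> indep I E \<Longrightarrow> card I + r < h + 2"
    and small: "card U + r < (r + 2) * h"
  shows "spanned E h (insert x U)"
proof -
  obtain T where T: "T \<subseteq> E" "tree U T" and deg: "\<And>t. card (neighbors T t) \<le> h"
    using sp unfolding spanned_def by blast
  have fin: "finite U" "finite T" using tree_finite[OF T(2)] by auto
  note edge = tree_edge[OF T(2)]
  have finN: "finite (neighbors T y)" for y using tree_finite_neighbors[OF T(2)] .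
  define N where "N = neighbors T t"
  have NU: "N \<subseteq> U" using tree_neighbors_subset[OF T(2)] by (simp add: N_def)
  show ?thesis
  proof (cases "card N < h")
    case True
    have "tree (insert x U) (insert {t, x} T)" using T tx by (intro tree.leaf)
    moreover have "card (neighbors (insert {t, x} T) y) \<le> h" for y
      using deg[of y] True h by (simp add: card_neighbors_leaf[OF T(2) tx(1,2)] N_def)
    ultimately show ?thesis unfolding spanned_def using T(1) tx(3) by (meson insert_subset)
  next
    case False
    then have cardN: "card N = h" using deg[of t] by (simp add: N_def)
    show ?thesis
    proof (cases "\<exists>w\<in>N. {x, w} \<in> E")
      case True
      then obtain w where w: "{t, w} \<in> T" "{x, w} \<in> E" by (auto simp: N_def neighbors_def)
      define T' where "T' = insert {t, x} (insert {x, w} (T - {{t, w}}))"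
      have tr: "tree (insert x U) T'" unfolding T'_def using tree_subdivide T(2) w(1) tx(2) .
      have "card (neighbors T' y) \<le> h" for y
      proof -
        have tw: "t \<noteq> w" "w \<noteq> x" "t \<noteq> x" using edge[OF w(1)] tx by auto
        consider "y = x" | "y = t" | "y = w" | "y \<noteq> x" "y \<noteq> t" "y \<noteq> w" by blast
        then show ?thesis
        proof cases
          case 1
          have "neighbors T' x \<subseteq> {t, w}"
            using edge tx(2) by (auto simp: neighbors_def T'_def doubleton_eq_iff)
          then have "card (neighbors T' x) \<le> card {t, w}" by (intro card_mono) auto
          then show ?thesis using 1 h tw by simp
        next
          case 2
          have "neighbors T' t \<subseteq> insert x (neighbors T t - {w})"
            using tw by (auto simp: neighbors_def T'_def doubleton_eq_iff)
          then have "card (neighbors T' t) \<le> card (neighbors T t)"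
            using w(1,2) by (intro card_le_exchange[OF finN, of w]) (auto simp: neighbors_def insert_commute)
          then show ?thesis using deg[of t] 2 by simp
        next
          case 3
          have "neighbors T' w \<subseteq> insert x (neighbors T w - {t})"
            using tw by (auto simp: neighbors_def T'_def doubleton_eq_iff)
          then have "card (neighbors T' w) \<le> card (neighbors T w)"
            using w(1,2) by (intro card_le_exchange[OF finN, of t]) (auto simp: neighbors_def insert_commute)
          then show ?thesis using deg[of w] 3 by simp
        next
          case 4
          have "neighbors T' y \<subseteq> neighbors T y"
            using 4 by (auto simp: neighbors_def T'_def doubleton_eq_iff)
          then show ?thesis using deg[of y] card_mono[OF finN] le_trans by blast
        qed
      qed
      moreover have "T' \<subseteq> E" using T(1) tx(3) w(2) by (auto simp: T'_def)
      ultimately show ?thesis unfolding spanned_def using tr by blast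
    next
      case noxw: False
      show ?thesis
      proof (cases "\<exists>w\<in>N. \<exists>w'\<in>N. w \<noteq> w' \<and> {w, w'} \<in> E \<and> card (neighbors T w) < h")
        case True
        then obtain w w' where w: "{t, w} \<in> T" "{t, w'} \<in> T" "w \<noteq> w'" "{w, w'} \<in> E"
            "card (neighbors T w) < h"
          by (auto simp: N_def neighbors_def)
        define T1 where "T1 = insert {w, w'} (T - {{t, w'}})"
        have tr1: "tree U T1" unfolding T1_def by (rule tree_swap[OF T(2) w(1-3)])
        have tr: "tree (insert x U) (insert {t, x} T1)" using tr1 tx by (intro tree.leaf)
        have tw: "t \<noteq> w" "t \<noteq> w'" using edge[OF w(1)] edge[OF w(2)] by auto
        \<comment> \<open>The swap takes the neighbor \<open>w'\<close> away from \<open>t\<close>,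
          which makes room for the leaf \<open>x\<close>.\<close>
        have t1: "card (neighbors T1 t) < h"
        proof -
          have "neighbors T1 t \<subseteq> N - {w'}"
            using tw by (auto simp: neighbors_def T1_def N_def doubleton_eq_iff)
          moreover have "w' \<in> N" using w by (simp add: N_def neighbors_def)
          ultimately have "neighbors T1 t \<subset> N" by blast
          then show ?thesis using psubset_card_mono[OF finN[of t]] cardN by (simp add: N_def)
        qed
        have "card (neighbors T1 y) \<le> h" for y
        proof -
          consider "y = t" | "y = w" | "y = w'" | "y \<noteq> t" "y \<noteq> w" "y \<noteq> w'" by blast
          then show ?thesis
          proof cases
            case 1
            then show ?thesis using t1 by simp
          next
            case 2
            have "neighbors T1 w \<subseteq> insert w' (neighbors T w)"
              using w(3) by (auto simp: neighbors_def T1_def doubleton_eq_iff)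
            then have "card (neighbors T1 w) \<le> card (insert w' (neighbors T w))"
              using finN by (intro card_mono) auto
            also have "\<dots> \<le> Suc (card (neighbors T w))" by (simp add: card_insert_if finN)
            finally show ?thesis using 2 w(5) by simp
          next
            case 3
            have "neighbors T1 w' \<subseteq> insert w (neighbors T w' - {t})"
              using w(3) tw by (auto simp: neighbors_def T1_def doubleton_eq_iff)
            then have "card (neighbors T1 w') \<le> card (neighbors T w')"
              using w(1,2) by (intro card_le_exchange[OF finN, of t]) (auto simp: neighbors_def insert_commute)
            then show ?thesis using deg[of w'] 3 by simp
          next
            case 4
            have "neighbors T1 y \<subseteq> neighbors T y"
              using 4 by (auto simp: neighbors_def T1_def doubleton_eq_iff)
            then show ?thesis using deg[of y] card_mono[OF finN] le_trans by blast
          qed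
        qed
        then have "card (neighbors (insert {t, x} T1) y) \<le> h" for y
          using t1 h by (simp add: card_neighbors_leaf[OF tr1 tx(1,2)])
        moreover have "insert {t, x} T1 \<subseteq> E" using T(1) tx(3) w(4) by (auto simp: T1_def)
        ultimately show ?thesis unfolding spanned_def using tr by blast
      next
        case noww: False
        define B where "B = {w \<in> N. card (neighbors T w) = h}"
        have BN: "B \<subseteq> N" "finite B" "finite N" using finN by (auto simp: B_def N_def)
        have "t \<notin> B" using edge[of t t] by (auto simp: B_def N_def neighbors_def)
        \<comment> \<open>Otherwise \<open>t\<close> and \<open>r + 1\<close> full neighbors have
          degree sum \<open>(r + 2) * h\<close>. By \<open>tree_sum_degree\<close> this is less than
          \<open>card T + r + 2 = card U + r + 1\<close>, against \<open>small\<close>.\<close>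
        have "card B \<le> r"
        proof (rule ccontr)
          assume "\<not> card B \<le> r"
          then obtain B' where B': "B' \<subseteq> B" "card B' = Suc r" "finite B'"
            by (meson not_less_eq_eq obtain_subset_with_card_n)
          have "(\<Sum>a\<in>insert t B'. card (neighbors T a)) = (\<Sum>a\<in>insert t B'. h)"
            using B' cardN by (intro sum.cong) (auto simp: B_def N_def)
          also have "\<dots> = (r + 2) * h" using B' \<open>t \<notin> B\<close> by (subst sum.insert) auto
          finally have "(r + 2) * h < card T + card (insert t B')"
            using tree_sum_degree[OF T(2), of "insert t B'"] B' BN NU tx by auto
          moreover have "card (insert t B') = r + 2" using B' \<open>t \<notin> B\<close> by (subst card_insert_disjoint) auto
          ultimately show False using small tree_card[OF T(2)] by simp
        qed
        \<comment> \<open>Full vertices may be adjacent to each other, so only one of them, if any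
          exists, joins the independent set.\<close>
        obtain C where C: "C \<subseteq> B" "card C = min 1 (card B)"
          by (meson min.cobounded2 obtain_subset_with_card_n)
        have "finite C" using C BN finite_subset by blast
        have C1: "a = b" if "a \<in> C" "b \<in> C" for a b
          using C(2) \<open>finite C\<close> that card_le_Suc0_iff_eq[of C] by auto
        define I where "I = insert x ((N - B) \<union> C)"
        have "indep I E"
          unfolding indep_def
        proof (intro ballI impI)
          fix a b assume ab: "a \<in> I" "b \<in> I" "a \<noteq> b"
          have sm: "card (neighbors T y) < h" if "y \<in> N - B" for y
            using that deg[of y] by (auto simp: B_def)
          have *: "{p, q} \<notin> E" if "p \<in> N - B" "q \<in> N" "p \<noteq> q" for p q
            using noww that sm[of p] by blast
          have CN: "C \<subseteq> N" using C BN by blast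
          consider "a = x" "b \<in> N" | "b = x" "a \<in> N" | "a \<in> N - B" "b \<in> N" | "b \<in> N - B" "a \<in> N"
            using ab CN C1[of a b] unfolding I_def by blast
          then show "{a, b} \<notin> E"
            using noxw *[of a b] *[of b a] ab(3) by cases (auto simp: insert_commute)
        qed
        moreover have "I \<subseteq> neighbors E t"
          using C BN T(1) tx(3) by (auto simp: I_def N_def neighbors_def)
        ultimately have "card I + r < h + 2" using star by blast
        moreover have "card I = Suc (card ((N - B) \<union> C))"
          using BN \<open>finite C\<close> C NU tx(2) unfolding I_def by (subst card_insert_disjoint) auto
        moreover have "card ((N - B) \<union> C) = card (N - B) + card C"
          using BN \<open>finite C\<close> C by (intro card_Un_disjoint) auto
        moreover have "card (N - B) = h - card B"
          using BN cardN by (simp add: card_Diff_subset)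
        moreover have "card B \<le> h" using BN cardN by (metis card_mono)
        \<comment> \<open>\<open>I\<close> has \<open>h + 1 - card B + min 1 (card B)\<close>
          elements. This is at least \<open>h + 2 - r\<close>, as \<open>card B \<le> r\<close> and
          \<open>r \<ge> 1\<close>, and contradicts \<open>star\<close>.\<close>
        ultimately have False using C(2) \<open>card B \<le> r\<close> r by (auto simp: min_def split: if_splits)
        then show ?thesis ..
      qed
    qed
  qed
qed

subsection \<open>Proper connection through a tree\<close>

lemma connected_crossing_edge:
  assumes "connected_graph V E" "X \<inter> V \<noteq> {}" "y \<in> V" "y \<notin> X"
  obtains u z where "u \<in> V" "u \<in> X" "z \<in> V" "z \<notin> X" "{u, z} \<in> E"
proof -
  obtain x where x: "x \<in> V" "x \<in> X" using assms by blast
  then obtain xs where "path_between V E x xs y"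
    using assms unfolding connected_graph_def by blast
  then have "xs \<noteq> []" "set xs \<subseteq> V" "successively (\<lambda>x y. {x, y} \<in> E) xs" "hd xs \<in> X" "last xs \<notin> X"
    using x assms by (auto simp: path_between_def)
  then have "\<exists>u z. u \<in> V \<and> u \<in> X \<and> z \<in> V \<and> z \<notin> X \<and> {u, z} \<in> E"
  proof (induction xs rule: induct_list012)
    case (3 a b xs)
    then show ?case by (cases "b \<in> X") auto
  qed auto
  then show ?thesis using that by blast
qed

lemma independence_number_ge:
  assumes "finite V" "S \<subseteq> V" "indep S E"
  shows "card S \<le> independence_number V E"
proof -
  have "finite {card S |S. S \<subseteq> V \<and> indep S E}"
    using assms(1) by (auto intro: finite_subset[of _ "card ` Pow V"])
  then show ?thesis unfolding independence_number_def using assms by (intro Max_ge) auto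
qed

lemma pc_opt_le:
  assumes "finite T" "T \<subseteq> E" "1 \<notin> c ` T" "\<And>e. e \<in> E - T \<Longrightarrow> c e = 1" "properly_connected V E c"
  shows "pc_opt V E \<le> card T + card (c ` T)"
proof -
  have "recoloring E (card T) (card (c ` T)) c"
    unfolding recoloring_def using assms by blast
  then show ?thesis unfolding pc_opt_def using assms(5) by (intro Least_le) blast
qed

lemma path_edges_Cons: "xs \<noteq> [] \<Longrightarrow> path_edges (x # xs) = insert {x, hd xs} (path_edges xs)"
proof
  assume xs: "xs \<noteq> []"
  show "path_edges (x # xs) \<subseteq> insert {x, hd xs} (path_edges xs)"
  proof
    fix e assume "e \<in> path_edges (x # xs)"
    then obtain i where i: "e = {(x # xs) ! i, (x # xs) ! Suc i}" "Suc i < length (x # xs)"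
      by (auto simp: path_edges_def)
    show "e \<in> insert {x, hd xs} (path_edges xs)"
    proof (cases i)
      case 0
      then show ?thesis using i xs by (simp add: hd_conv_nth)
    next
      case (Suc j)
      then show ?thesis using i by (auto simp: path_edges_def)
    qed
  qed
  show "insert {x, hd xs} (path_edges xs) \<subseteq> path_edges (x # xs)"
  proof -
    have "{x, hd xs} \<in> path_edges (x # xs)"
      unfolding path_edges_def using xs by (auto simp: hd_conv_nth intro!: exI[of _ 0])
    moreover have "path_edges xs \<subseteq> path_edges (x # xs)"
    proof
      fix e assume "e \<in> path_edges xs"
      then obtain i where "e = {xs ! i, xs ! Suc i}" "Suc i < length xs" by (auto simp: path_edges_def)
      then show "e \<in> path_edges (x # xs)"
        unfolding path_edges_def by (auto intro!: exI[of _ "Suc i"])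
    qed
    ultimately show ?thesis by blast
  qed
qed

lemma path_edges_singleton: "path_edges [x] = {}"
  by (simp add: path_edges_def)

lemma path_edges_snoc: "xs \<noteq> [] \<Longrightarrow> path_edges (xs @ [y]) = insert {last xs, y} (path_edges xs)"
proof (induction xs)
  case (Cons a xs)
  then show ?case
    by (cases "xs = []") (auto simp: path_edges_Cons path_edges_singleton hd_append)
qed simp

text \<open>Color 1 does not occur on \<open>T\<close>, so a properly colored path in
  \<open>T\<close> stays so when an edge of color 1 is added at one end, or at both ends if the two
  edges are disjoint.\<close>

lemma tree_properly_connected:
  assumes G: "connected_graph V E" and T: "T \<subseteq> E" "tree U T" and U: "U \<subseteq> V" "S \<subseteq> U"
    and col: "1 \<notin> c ` T" "\<And>e. e \<in> E - T \<Longrightarrow> c e = 1" "properly_colored c T"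
    and dom: "\<And>y. y \<in> V - U \<Longrightarrow> \<exists>s\<in>S. {s, y} \<in> E"
    and exch: "\<And>x y. x \<in> V - U \<Longrightarrow> y \<in> V - U \<Longrightarrow> x \<noteq> y \<Longrightarrow> {x, y} \<notin> E \<Longrightarrow>
      \<exists>s\<in>S. \<exists>s'\<in>S. s \<noteq> s' \<and> {x, s} \<in> E \<and> {s', y} \<in> E"
  shows "properly_connected V E c"
  unfolding properly_connected_def
proof (intro ballI impI)
  fix u v assume uv: "u \<in> V" "v \<in> V" "u \<noteq> v"
  have path: "\<exists>xs. path_between V E a xs b \<and> set xs \<subseteq> U \<and> (\<forall>f\<in>path_edges xs. c f \<noteq> 1) \<and>
      properly_colored c (path_edges xs)" if ab: "a \<in> U" "b \<in> U" for a b
  proof -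
    obtain xs where xs: "path_between U T a xs b" using tree_path[OF T(2) ab] by blast
    have "path_edges xs \<subseteq> T" using path_edges_subset[OF xs] .
    moreover have "path_between V E a xs b"
      using xs T(1) U(1) unfolding path_between_def by (auto elim: successively_mono)
    moreover have "set xs \<subseteq> U" using xs by (simp add: path_between_def)
    moreover have "\<forall>f\<in>path_edges xs. c f \<noteq> 1" using \<open>path_edges xs \<subseteq> T\<close> col(1) by force
    ultimately show ?thesis using properly_colored_subset[OF col(3)] by blast
  qed
  have out: "c {a, b} = 1" "{a, b} \<notin> T" if "a \<notin> U" "{a, b} \<in> E" for a b
    using that col(2) tree_edge_subset[OF T(2)] by blast+
  have out': "c {b, a} = 1" if "a \<notin> U" "{b, a} \<in> E" for a b
    using that out[of a b] by (simp add: insert_commute)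
  consider "u \<in> U" "v \<in> U" | "u \<in> U" "v \<notin> U" | "u \<notin> U" "v \<in> U"
    | "u \<notin> U" "v \<notin> U" "{u, v} \<in> E" | "u \<notin> U" "v \<notin> U" "{u, v} \<notin> E" by blast
  then show "\<exists>xs. path_between V E u xs v \<and> properly_colored c (path_edges xs)"
  proof cases
    case 1
    then show ?thesis using path by blast
  next
    case 2
    then obtain s where s: "s \<in> S" "{s, v} \<in> E" using dom uv by blast
    then obtain xs where xs: "path_between V E u xs s" "set xs \<subseteq> U" "\<forall>f\<in>path_edges xs. c f \<noteq> 1"
        "properly_colored c (path_edges xs)"
      using path[OF 2(1)] U by blast
    have "path_between V E u (xs @ [v]) v"
      using xs 2 s uv by (auto simp: path_between_def successively_append_iff)
    moreover have "properly_colored c (path_edges (xs @ [v]))"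
    proof -
      have "xs \<noteq> []" "last xs = s" using xs by (auto simp: path_between_def)
      moreover have "c {s, v} = 1" using out' 2 s by blast
      ultimately show ?thesis using xs
        by (auto simp: path_edges_snoc intro!: properly_colored_insert)
    qed
    ultimately show ?thesis by blast
  next
    case 3
    then obtain s where s: "s \<in> S" "{s, u} \<in> E" using dom uv by blast
    then obtain xs where xs: "path_between V E s xs v" "set xs \<subseteq> U" "\<forall>f\<in>path_edges xs. c f \<noteq> 1"
        "properly_colored c (path_edges xs)"
      using path[OF _ 3(2)] U by blast
    have "path_between V E u (u # xs) v"
      using xs 3 s uv by (auto simp: path_between_def successively_Cons insert_commute)
    moreover have "properly_colored c (path_edges (u # xs))"
    proof -
      have "xs \<noteq> []" "hd xs = s" using xs by (auto simp: path_between_def)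
      moreover have "c {u, s} = 1" using out 3 s by (metis insert_commute)
      ultimately show ?thesis using xs
        by (auto simp: path_edges_Cons intro!: properly_colored_insert)
    qed
    ultimately show ?thesis by blast
  next
    case 4
    then have "path_between V E u [u, v] v" using uv by (simp add: path_between_def)
    moreover have "properly_colored c (path_edges [u, v])"
      by (simp add: path_edges_Cons path_edges_singleton properly_colored_def)
    ultimately show ?thesis by blast
  next
    case 5
    then obtain s s' where s: "s \<in> S" "s' \<in> S" "s \<noteq> s'" "{u, s} \<in> E" "{s', v} \<in> E"
      using exch uv by blast
    then obtain xs where xs: "path_between V E s xs s'" "set xs \<subseteq> U" "\<forall>f\<in>path_edges xs. c f \<noteq> 1"
        "properly_colored c (path_edges xs)"
      using path U by blast
    have ends: "xs \<noteq> []" "hd xs = s" "last xs = s'" using xs by (auto simp: path_between_def)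
    have "path_between V E u (u # xs @ [v]) v"
      using xs 5 s uv by (auto simp: path_between_def successively_Cons successively_append_iff)
    moreover have "properly_colored c (path_edges (u # xs @ [v]))"
    proof -
      have c1: "c {s', v} = 1" "c {u, s} = 1" using out out' 5 s by blast+
      have "path_edges (u # xs @ [v]) = insert {u, s} (insert {s', v} (path_edges xs))"
        using ends by (simp add: path_edges_Cons path_edges_snoc)
      moreover have "properly_colored c (insert {s', v} (path_edges xs))"
        using xs c1 by (auto intro!: properly_colored_insert)
      \<comment> \<open>Both end edges have color 1, so they must not meet; this is where
        \<open>s \<noteq> s'\<close> enters.\<close>
      moreover have "{u, s} \<inter> {s', v} = {}" using s uv 5 U by auto
      ultimately show ?thesis using xs c1
        by (auto intro!: properly_colored_insert)
    qed
    ultimately show ?thesis by blast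
  qed
qed

lemma indep_insert:
  assumes "indep S E" "\<And>s. s \<in> S \<Longrightarrow> {s, z} \<notin> E"
  shows "indep (insert z S) E"
  using assms by (auto simp: indep_def insert_commute)

lemma indep_subset: "indep S E \<Longrightarrow> S' \<subseteq> S \<Longrightarrow> indep S' E"
  by (auto simp: indep_def)

subsection \<open>Growing the tree\<close>

lemma spanned_star:
  assumes G: "simple_graph V E" and v: "v \<in> V"
    and h: "h \<ge> 2" and r: "r \<ge> 1"
    and star: "\<forall>t\<in>V. \<forall>I \<subseteq> neighbors E t. indep I E \<longrightarrow> card I + r < h + 2"
    and W: "finite W" "W \<subseteq> neighbors E v" and small: "card W + r < (r + 2) * h"
  shows "spanned E h (insert v W)"
  using W small
proof (induction rule: finite_induct)
  case empty
  have "spanned E h {v}"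
    unfolding spanned_def by (intro exI[of _ "{}"]) (simp add: tree.single neighbors_def)
  then show ?case .
next
  case (insert x W)
  have "{v, x} \<in> E" using insert.prems by (simp add: neighbors_def)
  then have "x \<noteq> v" using G by (auto simp: simple_graph_def nsets_def)
  have "card (insert v W) \<le> card (insert x W)" using insert.hyps by (simp add: card_insert_if)
  then have "spanned E h (insert x (insert v W))"
    using insert \<open>{v, x} \<in> E\<close> \<open>x \<noteq> v\<close> star v
    by (intro spanned_attach[of E h _ v x r] h r) auto
  then show ?case by (simp add: insert_commute)
qed

text \<open>The growth process becomes an extremal choice: \<open>S\<close> is a largest independent
  set inside some spanned \<open>U\<close> with \<open>card U + m \<le> 2 * card S + 1\<close>. One
  more element of \<open>S\<close> at the price of at most two vertices of \<open>U\<close>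
  preserves this inequality, so a failure of either property contradicts maximality.\<close>

lemma exists_dominating_spanned:
  assumes G: "connected_graph V E" and h: "h \<ge> 2" and r: "r \<ge> 1"
    and star: "\<forall>t\<in>V. \<forall>I \<subseteq> neighbors E t. indep I E \<longrightarrow> card I + r < h + 2"
    and small: "2 * independence_number V E + r < (r + 2) * h + m"
    and start: "A \<subseteq> B" "B \<subseteq> V" "A \<noteq> {}" "indep A E" "spanned E h B"
      "card B + m \<le> 2 * card A + 1"
  obtains S U where "S \<subseteq> U" "U \<subseteq> V" "indep S E" "spanned E h U" "card U + m \<le> 2 * card S + 1"
    "\<And>y. y \<in> V - U \<Longrightarrow> \<exists>s\<in>S. {s, y} \<in> E"
    "\<And>x y. x \<in> V - U \<Longrightarrow> y \<in> V - U \<Longrightarrow> x \<noteq> y \<Longrightarrow> {x, y} \<notin> E \<Longrightarrow>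
      \<exists>s\<in>S. \<exists>s'\<in>S. s \<noteq> s' \<and> {x, s} \<in> E \<and> {s', y} \<in> E"
proof -
  have finV: "finite V"
    using G by (auto simp: connected_graph_def simple_graph_def)
  define k where "k = independence_number V E"
  define P where "P S \<longleftrightarrow> S \<noteq> {} \<and> indep S E \<and> (\<exists>U. S \<subseteq> U \<and> U \<subseteq> V \<and> spanned E h U \<and>
    card U + m \<le> 2 * card S + 1)" for S
  have Pk: "card S \<le> k" if "P S" for S
    using that independence_number_ge[OF finV, of S E] unfolding P_def k_def by blast
  have "P A" using start unfolding P_def by blast
  then have "\<exists>S. P S \<and> (\<forall>S'. P S' \<longrightarrow> card S' \<le> card S)"
    using Pk by (intro ex_has_greatest_nat[of P A card "Suc k"]) (simp_all add: le_imp_less_Suc)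
  then obtain S where S: "P S" and Smax: "\<And>S'. P S' \<Longrightarrow> card S' \<le> card S"
    by auto
  then obtain U where U: "S \<noteq> {}" "indep S E" "S \<subseteq> U" "U \<subseteq> V" "spanned E h U"
      "card U + m \<le> 2 * card S + 1"
    unfolding P_def by blast
  have "finite U" using finite_subset[OF U(4) finV] .
  then have finU: "finite U" "finite S" using finite_subset[OF U(3)] by auto
  \<comment> \<open>The last premise, together with \<open>small\<close>, gives the size bound that
    \<open>spanned_attach\<close> asks for.\<close>
  have attach: "spanned E h (insert x U')"
    if "spanned E h U'" "U' \<subseteq> V" "t \<in> U'" "x \<notin> U'" "{t, x} \<in> E" "card U' + m \<le> 2 * k" for U' t x
    using that small star by (intro spanned_attach[of E h _ t x r] h r) (auto simp: k_def)
  have no_ext: False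
    if "indep S' E" "S' \<subseteq> U'" "U' \<subseteq> V" "spanned E h U'" "card U' \<le> card U + 2"
      "card S' = Suc (card S)" for S' U'
  proof -
    have "S' \<noteq> {}" using that(6) by auto
    moreover have "card U' + m \<le> 2 * card S' + 1" using that(5,6) U(6) by simp
    ultimately have "P S'" using that unfolding P_def by blast
    then show False using Smax[of S'] that(6) by simp
  qed
  \<comment> \<open>The larger independent set gives \<open>card U + m \<le> 2 * k - 1\<close>,
    which leaves room for two successive attachments.\<close>
  have cardS: "card S < k" if "indep S' E" "S' \<subseteq> V" "card S' = Suc (card S)" for S'
    using independence_number_ge[OF finV that(2,1)] that(3) by (simp add: k_def)
  have dom: "\<exists>s\<in>S. {s, y} \<in> E" if y: "y \<in> V - U" for y
  proof (rule ccontr)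
    assume ny: "\<not> (\<exists>s\<in>S. {s, y} \<in> E)"
    \<comment> \<open>\<open>y\<close> may be far from \<open>S\<close>. An edge leaving the closed
      neighborhood \<open>X\<close> of \<open>S\<close> leads to a vertex \<open>z\<close> at
      distance two, which joins \<open>S\<close> instead of \<open>y\<close>; \<open>u\<close> links
      it to the tree.\<close>
    define X where "X = S \<union> {u. \<exists>s\<in>S. {s, u} \<in> E}"
    have "X \<inter> V \<noteq> {}" "y \<notin> X" "y \<in> V" using U ny y by (auto simp: X_def)
    then obtain u z where uz: "u \<in> V" "u \<in> X" "z \<in> V" "z \<notin> X" "{u, z} \<in> E"
      using connected_crossing_edge[OF G] by metis
    then obtain s where s: "s \<in> S" "{s, u} \<in> E" by (auto simp: X_def)
    have uS: "u \<noteq> z" using uz by auto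
    have ind: "indep (insert z S) E" using U(2) uz by (intro indep_insert) (auto simp: X_def)
    have zS: "z \<notin> S" using uz by (auto simp: X_def)
    have card: "card (insert z S) = Suc (card S)" using zS finU by simp
    have Sk: "card S < k" using cardS[OF ind _ card] U uz by blast
    show False
    proof (cases "z \<in> U")
      case True
      then show False using no_ext[OF ind, of U] U card by auto
    next
      case z: False
      show False
      proof (cases "u \<in> U")
        case True
        then have "spanned E h (insert z U)" using attach[of U u z] U z uz Sk by auto
        then show False using no_ext[OF ind, of "insert z U"] U card finU z uz by auto
      next
        case False
        have "spanned E h (insert u U)" using attach[of U s u] U False s Sk by auto
        then have "spanned E h (insert z (insert u U))"
          using attach[of "insert u U" u z] U z uz Sk False finU uS by auto
        then show False
          using no_ext[OF ind, of "insert z (insert u U)"] U card finU z uz False uS by auto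
      qed
    qed
  qed
  have exch: "\<exists>s\<in>S. \<exists>s'\<in>S. s \<noteq> s' \<and> {x, s} \<in> E \<and> {s', y} \<in> E"
    if xy: "x \<in> V - U" "y \<in> V - U" "x \<noteq> y" "{x, y} \<notin> E" for x y
  proof (rule ccontr)
    assume no: "\<not> ?thesis"
    obtain s where s: "s \<in> S" "{s, x} \<in> E" using dom xy by blast
    obtain s' where s': "s' \<in> S" "{s', y} \<in> E" using dom xy by blast
    \<comment> \<open>Hence \<open>s\<close> is the only neighbor in \<open>S\<close> of both
      \<open>x\<close> and \<open>y\<close>, and exchanging it for these two keeps the set
      independent.\<close>
    have eq: "s' = s" using no s s' by (metis insert_commute)
    have only: "p = s" if "p \<in> S" "{p, x} \<in> E \<or> {p, y} \<in> E" for p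
      using no that s s' eq by (metis insert_commute)
    define S' where "S' = insert y (insert x (S - {s}))"
    have "indep (insert x (S - {s})) E"
      using U(2) only by (intro indep_insert) (auto intro: indep_subset)
    then have ind: "indep S' E"
      unfolding S'_def by (rule indep_insert) (use only xy in auto)
    have xyS: "x \<notin> S" "y \<notin> S" using xy U by auto
    have "card (S - {s}) = card S - 1" "card S > 0" using s finU by (auto simp: card_gt_0_iff)
    then have card: "card S' = Suc (card S)"
      unfolding S'_def using xyS xy finU by simp
    have Sk: "card S < k" using cardS[OF ind _ card] U xy unfolding S'_def by blast
    have "spanned E h (insert x U)" using attach[of U s x] U s xy Sk by auto
    then have "spanned E h (insert y (insert x U))"
      using attach[of "insert x U" s y] U s' eq xy Sk finU by auto
    then show False
      using no_ext[OF ind, of "insert y (insert x U)"] U card finU xy unfolding S'_def by auto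
  qed
  show ?thesis using that[OF U(3,4,2,5,6) dom exch] by blast
qed

text \<open>The final tree has \<open>card U - 1 \<le> 2 * card S - card W\<close> edges and takes
  at most \<open>h\<close> colors. The parameter \<open>r\<close> is a trade-off: raising it
  tightens \<open>star\<close> but, as \<open>h \<ge> 2\<close>, relaxes
  \<open>small\<close>.\<close>

lemma pc_opt_le_of_star:
  assumes G: "connected_graph V E" and h: "h \<ge> 2" and r: "r \<ge> 1"
    and star: "\<forall>t\<in>V. \<forall>I \<subseteq> neighbors E t. indep I E \<longrightarrow> card I + r < h + 2"
    and small: "2 * independence_number V E + r < (r + 2) * h + card W"
    and W: "v \<in> V" "W \<noteq> {}" "W \<subseteq> neighbors E v" "indep W E"
  shows "pc_opt V E + card W \<le> 2 * independence_number V E + h"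
proof -
  have sg: "simple_graph V E" using G by (simp add: connected_graph_def)
  then have finV: "finite V" and EV: "E \<subseteq> [V]\<^bsup>2\<^esup>" by (auto simp: simple_graph_def)
  have WV: "W \<subseteq> V" using W EV by (auto simp: neighbors_def nsets_def)
  then have finW: "finite W" using finV finite_subset by blast
  have "card W \<le> independence_number V E" using independence_number_ge[OF finV WV W(4)] .
  then have sp: "spanned E h (insert v W)"
    using small by (intro spanned_star[OF sg W(1) h r star finW W(3)]) auto
  have cd: "card (insert v W) + card W \<le> 2 * card W + 1"
    using finW by (simp add: card_insert_if)
  have "W \<subseteq> insert v W" "insert v W \<subseteq> V" using W WV by auto
  then obtain S U where SU: "S \<subseteq> U" "U \<subseteq> V" "indep S E" "spanned E h U"
    "card U + card W \<le> 2 * card S + 1"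
    "\<And>y. y \<in> V - U \<Longrightarrow> \<exists>s\<in>S. {s, y} \<in> E"
    "\<And>x y. x \<in> V - U \<Longrightarrow> y \<in> V - U \<Longrightarrow> x \<noteq> y \<Longrightarrow> {x, y} \<notin> E \<Longrightarrow>
      \<exists>s\<in>S. \<exists>s'\<in>S. s \<noteq> s' \<and> {x, s} \<in> E \<and> {s', y} \<in> E"
    using exists_dominating_spanned[OF G h r star small _ _ W(2,4) sp cd] by blast
  obtain T where T: "T \<subseteq> E" "tree U T" "\<And>t. card (neighbors T t) \<le> h"
    using SU(4) by (auto simp: spanned_def)
  obtain c0 where c0: "c0 ` T \<subseteq> {2..<h + 2}" "properly_colored c0 T"
    using tree_coloring[OF T(2,3)] by blast
  define c where "c e = (if e \<in> T then c0 e else 1)" for e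
  have cT: "c ` T = c0 ` T" by (auto simp: c_def)
  then have ne1: "1 \<notin> c ` T" using c0(1) by auto
  have "properly_colored c T" using c0(2) by (simp add: properly_colored_def c_def)
  then have "properly_connected V E c"
    using SU ne1 by (intro tree_properly_connected[OF G T(1,2) SU(2,1)]) (auto simp: c_def)
  then have "pc_opt V E \<le> card T + card (c ` T)"
    using tree_finite[OF T(2)] T(1) ne1 by (intro pc_opt_le) (auto simp: c_def)
  moreover have "card (c ` T) \<le> h" using card_mono[OF _ c0(1)] cT by simp
  moreover have "card U = Suc (card T)" using tree_card[OF T(2)] .
  moreover have "card S \<le> independence_number V E"
    using independence_number_ge[OF finV] SU by blast
  ultimately show ?thesis using SU(5) by linarith
qed

section \<open>Choice of the star and of the degree bound\<close>

theorem theorem1p2: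
  fixes V :: "'a set" and E :: "'a set set"
  assumes "connected_graph V E"
  shows "real (pc_opt V E) \<le> (5 * real (independence_number V E) - 1) / 2"
proof -
  define k where "k = independence_number V E"
  have finV: "finite V" and neV: "V \<noteq> {}" and EV: "E \<subseteq> [V]\<^bsup>2\<^esup>"
    using assms by (auto simp: connected_graph_def simple_graph_def)
  have ge: "card I \<le> k" if "I \<subseteq> V" "indep I E" for I
    using independence_number_ge[OF finV that] by (simp add: k_def)
  have nV: "neighbors E t \<subseteq> V" for t using EV by (auto simp: neighbors_def nsets_def)
  have "2 * pc_opt V E + 1 \<le> 5 * k"
  proof (cases "\<forall>u\<in>V. \<forall>v\<in>V. u \<noteq> v \<longrightarrow> {u, v} \<in> E")
    case True
    obtain w where "w \<in> V" using neV by blast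
    then have "k \<ge> 1" using ge[of "{w}"] by (simp add: indep_def)
    have "properly_connected V E (\<lambda>_. 1)"
      unfolding properly_connected_def
    proof (intro ballI impI)
      fix u v assume uv: "u \<in> V" "v \<in> V" "u \<noteq> v"
      have "path_between V E u [u, v] v" using uv True by (simp add: path_between_def)
      moreover have "properly_colored (\<lambda>_. 1) (path_edges [u, v])"
        by (simp add: path_edges_Cons path_edges_singleton properly_colored_def)
      ultimately show "\<exists>xs. path_between V E u xs v \<and> properly_colored (\<lambda>_. 1) (path_edges xs)"
        by blast
    qed
    then have "pc_opt V E \<le> 0" using pc_opt_le[of "{}" E "\<lambda>_. 1" V] by simp
    then show ?thesis using \<open>k \<ge> 1\<close> by simp
  next
    case False
    then obtain a b where ab: "a \<in> V" "b \<in> V" "a \<noteq> b" "{a, b} \<notin> E" by blast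
    then have "insert a (neighbors E a) \<inter> V \<noteq> {}" "b \<notin> insert a (neighbors E a)"
      by (auto simp: neighbors_def)
    \<comment> \<open>An edge leaving the closed neighborhood of \<open>a\<close> yields an induced
      path from \<open>a\<close> over \<open>y\<close> to \<open>z\<close>, so that a largest
      independent set in a neighborhood has at least two elements.\<close>
    then obtain y z where yz: "y \<in> V" "y \<in> insert a (neighbors E a)" "z \<in> V"
        "z \<notin> insert a (neighbors E a)" "{y, z} \<in> E"
      using connected_crossing_edge[OF assms _ ab(2)] by metis
    have az: "{a, z} \<subseteq> neighbors E y" "indep {a, z} E" "a \<noteq> z"
      using yz by (auto simp: neighbors_def indep_def insert_commute)
    define P where "P I \<longleftrightarrow> indep I E \<and> (\<exists>t\<in>V. I \<subseteq> neighbors E t)" for I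
    have "P {a, z}" unfolding P_def using az yz by blast
    moreover have Pk: "card I \<le> k" if "P I" for I using that nV ge unfolding P_def by blast
    ultimately have "\<exists>W. P W \<and> (\<forall>I. P I \<longrightarrow> card I \<le> card W)"
      by (intro ex_has_greatest_nat[of P "{a, z}" card "Suc k"]) (simp_all add: le_imp_less_Suc)
    then obtain W where W: "P W" "\<And>I. P I \<Longrightarrow> card I \<le> card W"
      by auto
    define m where "m = card W"
    have m: "2 \<le> m" "m \<le> k" using W Pk \<open>P {a, z}\<close> az(3) unfolding m_def by fastforce+
    obtain t where t: "t \<in> V" "W \<subseteq> neighbors E t" "indep W E" using W unfolding P_def by blast
    have neW: "W \<noteq> {}" using m by (auto simp: m_def)
    have max: "card I \<le> m" if "s \<in> V" "I \<subseteq> neighbors E s" "indep I E" for s I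
      using W(2)[of I] that unfolding P_def m_def by blast
    show ?thesis
    \<comment> \<open>Here \<open>m = 2\<close>, and the general formula for \<open>h\<close> would
      give only \<open>h = m\<close>, too small for \<open>r = 2\<close>; so \<open>h = 2\<close> is
      used with \<open>r = 1\<close>.\<close>
    proof (cases "k = 2")
      case True
      have "pc_opt V E + card W \<le> 2 * independence_number V E + 2"
      proof (rule pc_opt_le_of_star[OF assms _ _ _ _ t(1) neW t(2,3), of 2 1])
        show "\<forall>s\<in>V. \<forall>I \<subseteq> neighbors E s. indep I E \<longrightarrow> card I + 1 < 2 + 2"
          using le_imp_less_Suc[OF le_trans[OF max m(2)]] True by simp
        show "2 * independence_number V E + 1 < (1 + 2) * 2 + card W"
          using m True unfolding m_def k_def by simp
      qed auto
      then have "pc_opt V E + m \<le> 2 * k + 2" by (simp add: m_def k_def)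
      then show ?thesis using m True by simp
    next
      case False
      \<comment> \<open>Now \<open>k \<ge> 3\<close>, so \<open>h \<ge> m + 1\<close>, which is the
        star condition for \<open>r = 2\<close>. Rounding down gives
        \<open>2 * h \<le> 2 * m + k - 1\<close>, exactly what turns \<open>2 * k - m + h\<close>
        into the claimed bound.\<close>
      define h where "h = m + (k - 1) div 2"
      have h: "h \<ge> m + 1" "2 * h \<ge> 2 * m + k - 2" "2 * h \<le> 2 * m + k - 1"
        using m False by (auto simp: h_def)
      have "pc_opt V E + card W \<le> 2 * independence_number V E + h"
      proof (rule pc_opt_le_of_star[OF assms _ _ _ _ t(1) neW t(2,3), of h 2])
        show "\<forall>s\<in>V. \<forall>I \<subseteq> neighbors E s. indep I E \<longrightarrow> card I + 2 < h + 2"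
          using le_less_trans[OF max, of _ _ h] h(1) by simp
        show "2 * independence_number V E + 2 < (2 + 2) * h + card W"
          using h m unfolding m_def k_def by simp
      qed (use h m in auto)
      then have "pc_opt V E + m \<le> 2 * k + h" by (simp add: m_def k_def)
      then show ?thesis using h m by simp
    qed
  qed
  then show ?thesis by (simp add: k_def field_simps)
qed

end
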